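(* Let $(V,\mu,\nu,*,\diamond)$ be an intuitionistic fuzzy normed space with $V$ finite dimensional and $\diamond=\max$. Then $(V,\mu,\nu,*,\diamond)$ is complete.
   Context: A continuous t-norm is a binary operation $*:[0,1]\times[0,1]\to[0,1]$ that is associative, commutative, continuous, satisfies $a*1=a$ for all $a\in[0,1]$, and satisfies $a*b\le c*d$ whenever $a\le c$ and $b\le d$. A continuous t-conorm is a binary operation $\diamond:[0,1]\times[0,1]\to[0,1]$ that is associative, commutative, continuous, satisfies $a\diamond 0=a$ for all $a\in[0,1]$, and satisfies $a\diamond b\le c\diamond d$ whenever $a\le c$ and $b\le d$. Here $\diamond=\max$ means $a\diamond b=\max(a,b)$. An intuitionistic fuzzy normed space is a 5-tuple $(V,\mu,\nu,*,\diamond)$ where $V$ is a real vector space, $*$ is a continuous t-norm, $\diamond$ is a continuous t-conorm, and $\mu,\nu:V\times(0,\infty)\to[0,1]$ satisfy, for all $x,y\in V$ and $t,s>0$: (a) $\mu(x,t)+\nu(x,t)\le1$; (b) $\mu(x,t)>0$; (c) $\mu(x,t)=1$ if and only if $x=0$; (d) $\mu(\alpha x,t)=\mu(x,t/|\alpha|)$ for each scalar $\alpha\ne0$; (e) $\mu(x,t)*\mu(y,s)\le\mu(x+y,t+s)$; (f) $\mu(x,\cdot):(0,\infty)\to[0,1]$ is continuous; (g) $\lim_{t\to\infty}\mu(x,t)=1$, and $\lim_{t\to0}\mu(x,t)=0$ if $x\neq 0$; (h) $\nu(x,t)<1$; (i) $\nu(x,t)=0$ if and only if $x=0$; (j) $\nu(\alpha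 x,t)=\nu(x,t/|\alpha|)$ for each scalar $\alpha\neq0$; (k) $\nu(x,t)\diamond\nu(y,s)\ge\nu(x+y,t+s)$; (l) $\nu(x,\cdot):(0,\infty)\to[0,1]$ is continuous; (m) $\lim_{t\to\infty}\nu(x,t)=0$, and $\lim_{t\to0}\nu(x,t)=1$ if $x\ne0$. A sequence $\{x_n\}$ in $V$ is Cauchy if for each $\varepsilon>0$ and $t>0$ there is $n_0\in\mathbb{N}$ with $\mu(x_n-x_m,t)>1-\varepsilon$ and $\nu(x_n-x_m,t)<\varepsilon$ for all $n,m\ge n_0$. It converges to $x\in V$ if $\mu(x_n-x,t)\to1$ and $\nu(x_n-x,t)\to0$ as $n\to\infty$ for every $t>0$. The space is complete if every Cauchy sequence is convergent. *)

theory Defs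
  imports "HOL-Analysis.Analysis"
begin

text \<open>
  Operations on $[0,1]$ are represented by functions on all reals, and functions on
  $V \times (0,\infty)$ by functions of a vector and an arbitrary real; every condition is
  restricted to the intended domain, so values outside it are irrelevant.
\<close>

locale continuous_t_norm =
  fixes T :: "real \<Rightarrow> real \<Rightarrow> real"
  assumes closed: "\<lbrakk>a \<in> {0..1}; b \<in> {0..1}\<rbrakk> \<Longrightarrow> T a b \<in> {0..1}"
    and assoc: "\<lbrakk>a \<in> {0..1}; b \<in> {0..1}; c \<in> {0..1}\<rbrakk> \<Longrightarrow> T (T a b) c = T a (T b c)"
    and commute: "\<lbrakk>a \<in> {0..1}; b \<in> {0..1}\<rbrakk> \<Longrightarrow> T a b = T b a"
    and continuous: "continuous_on ({0..1} \<times> {0..1}) (\<lambda>(a, b). T a b)"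
    and unit: "a \<in> {0..1} \<Longrightarrow> T a 1 = a"
    and mono: "\<lbrakk>a \<in> {0..1}; b \<in> {0..1}; c \<in> {0..1}; d \<in> {0..1}; a \<le> c; b \<le> d\<rbrakk>
      \<Longrightarrow> T a b \<le> T c d"

locale continuous_t_conorm =
  fixes S :: "real \<Rightarrow> real \<Rightarrow> real"
  assumes closed: "\<lbrakk>a \<in> {0..1}; b \<in> {0..1}\<rbrakk> \<Longrightarrow> S a b \<in> {0..1}"
    and assoc: "\<lbrakk>a \<in> {0..1}; b \<in> {0..1}; c \<in> {0..1}\<rbrakk> \<Longrightarrow> S (S a b) c = S a (S b c)"
    and commute: "\<lbrakk>a \<in> {0..1}; b \<in> {0..1}\<rbrakk> \<Longrightarrow> S a b = S b a"
    and continuous: "continuous_on ({0..1} \<times> {0..1}) (\<lambda>(a, b). S a b)"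
    and unit: "a \<in> {0..1} \<Longrightarrow> S a 0 = a"
    and mono: "\<lbrakk>a \<in> {0..1}; b \<in> {0..1}; c \<in> {0..1}; d \<in> {0..1}; a \<le> c; b \<le> d\<rbrakk>
      \<Longrightarrow> S a b \<le> S c d"

text \<open>The vector space $V$ is the whole type \<open>'v\<close>.\<close>

locale intuitionistic_fuzzy_normed_space =
  norm_op: continuous_t_norm T + conorm_op: continuous_t_conorm S
  for T S :: "real \<Rightarrow> real \<Rightarrow> real" +
  fixes \<mu> \<nu> :: "'v::real_vector \<Rightarrow> real \<Rightarrow> real"
  assumes mu_range: "t > 0 \<Longrightarrow> \<mu> x t \<in> {0..1}"
    and nu_range: "t > 0 \<Longrightarrow> \<nu> x t \<in> {0..1}"
    and mu_add_nu_le_1: "t > 0 \<Longrightarrow> \<mu> x t + \<nu> x t \<le> 1"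
    and mu_pos: "t > 0 \<Longrightarrow> \<mu> x t > 0"
    and mu_eq_1_iff: "t > 0 \<Longrightarrow> \<mu> x t = 1 \<longleftrightarrow> x = 0"
    and mu_scaleR: "\<lbrakk>t > 0; \<alpha> \<noteq> 0\<rbrakk> \<Longrightarrow> \<mu> (\<alpha> *\<^sub>R x) t = \<mu> x (t / \<bar>\<alpha>\<bar>)"
    and mu_add: "\<lbrakk>t > 0; s > 0\<rbrakk> \<Longrightarrow> T (\<mu> x t) (\<mu> y s) \<le> \<mu> (x + y) (t + s)"
    and mu_continuous: "continuous_on {0<..} (\<mu> x)"
    and mu_at_top: "(\<mu> x \<longlongrightarrow> 1) at_top"
    and mu_at_0: "x \<noteq> 0 \<Longrightarrow> (\<mu> x \<longlongrightarrow> 0) (at_right 0)"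
    and nu_less_1: "t > 0 \<Longrightarrow> \<nu> x t < 1"
    and nu_eq_0_iff: "t > 0 \<Longrightarrow> \<nu> x t = 0 \<longleftrightarrow> x = 0"
    and nu_scaleR: "\<lbrakk>t > 0; \<alpha> \<noteq> 0\<rbrakk> \<Longrightarrow> \<nu> (\<alpha> *\<^sub>R x) t = \<nu> x (t / \<bar>\<alpha>\<bar>)"
    and nu_add: "\<lbrakk>t > 0; s > 0\<rbrakk> \<Longrightarrow> S (\<nu> x t) (\<nu> y s) \<ge> \<nu> (x + y) (t + s)"
    and nu_continuous: "continuous_on {0<..} (\<nu> x)"
    and nu_at_top: "(\<nu> x \<longlongrightarrow> 0) at_top"
    and nu_at_0: "x \<noteq> 0 \<Longrightarrow> (\<nu> x \<longlongrightarrow> 1) (at_right 0)"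

definition ifn_Cauchy ::
  "('v::real_vector \<Rightarrow> real \<Rightarrow> real) \<Rightarrow> ('v \<Rightarrow> real \<Rightarrow> real) \<Rightarrow> (nat \<Rightarrow> 'v) \<Rightarrow> bool"
  where "ifn_Cauchy \<mu> \<nu> X \<longleftrightarrow>
    (\<forall>\<epsilon>>0. \<forall>t>0. \<exists>n0. \<forall>n\<ge>n0. \<forall>m\<ge>n0. \<mu> (X n - X m) t > 1 - \<epsilon> \<and> \<nu> (X n - X m) t < \<epsilon>)"

definition ifn_converges ::
  "('v::real_vector \<Rightarrow> real \<Rightarrow> real) \<Rightarrow> ('v \<Rightarrow> real \<Rightarrow> real) \<Rightarrow> (nat \<Rightarrow> 'v) \<Rightarrow> 'v \<Rightarrow> bool"
  where "ifn_converges \<mu> \<nu> X l \<longleftrightarrow>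
    (\<forall>t>0. (\<lambda>n. \<mu> (X n - l) t) \<longlonglongrightarrow> 1 \<and> (\<lambda>n. \<nu> (X n - l) t) \<longlonglongrightarrow> 0)"

definition ifn_complete ::
  "('v::real_vector \<Rightarrow> real \<Rightarrow> real) \<Rightarrow> ('v \<Rightarrow> real \<Rightarrow> real) \<Rightarrow> bool"
  where "ifn_complete \<mu> \<nu> \<longleftrightarrow>
    (\<forall>X. ifn_Cauchy \<mu> \<nu> X \<longrightarrow> (\<exists>l. ifn_converges \<mu> \<nu> X l))"

end

theory Submission
  imports Defs
begin

text \<open>
  The vectors \<open>z\<close> with \<open>\<mu> z t > 1 - t\<close> and \<open>\<nu> z t < t\<close>, for \<open>t > 0\<close>, form a countably generated base
  of balanced zero neighbourhoods of a Hausdorff vector space topology, and the Cauchy and convergent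
  sequences of the fuzzy normed space are exactly those of this topology. Completeness of the span of
  a finite set follows by induction on the set: if \<open>b\<close> is not in the complete (hence closed) subspace
  \<open>U\<close>, then \<open>b + U\<close> stays away from zero, so the \<open>b\<close>-coordinates of a Cauchy sequence in
  \<open>\<real> b + U\<close> form a Cauchy sequence of reals.
\<close>

section \<open>Sequences in a vector space topology given by zero neighbourhoods\<close>

locale zero_neighbourhoods =
  fixes small :: "real \<Rightarrow> 'v::real_vector \<Rightarrow> bool"
  assumes small_mono: "\<lbrakk>0 < s; s \<le> t; small s x\<rbrakk> \<Longrightarrow> small t x"
    and small_add: "0 < t \<Longrightarrow> \<exists>s>0. \<forall>x y. small s x \<longrightarrow> small s y \<longrightarrow> small t (x + y)"
    and small_balanced: "\<lbrakk>0 < t; \<bar>a\<bar> \<le> 1; small t x\<rbrakk> \<Longrightarrow> small t (a *\<^sub>R x)"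
    and small_scaleR: "\<lbrakk>0 < t; a \<noteq> 0\<rbrakk> \<Longrightarrow> \<exists>s>0. \<forall>x. small s x \<longrightarrow> small t (a *\<^sub>R x)"
    and small_absorbing: "0 < t \<Longrightarrow> \<exists>\<delta>>0. \<forall>a. \<bar>a\<bar> < \<delta> \<longrightarrow> small t (a *\<^sub>R x)"
    and small_Hausdorff: "(\<And>t. 0 < t \<Longrightarrow> small t x) \<Longrightarrow> x = 0"
begin

definition Cauchy_seq :: "(nat \<Rightarrow> 'v) \<Rightarrow> bool"
  where "Cauchy_seq X \<longleftrightarrow> (\<forall>t>0. \<exists>n0. \<forall>n\<ge>n0. \<forall>m\<ge>n0. small t (X n - X m))"

definition seq_lim :: "(nat \<Rightarrow> 'v) \<Rightarrow> 'v \<Rightarrow> bool"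
  where "seq_lim X l \<longleftrightarrow> (\<forall>t>0. \<forall>\<^sub>F n in sequentially. small t (X n - l))"

definition seq_complete :: "'v set \<Rightarrow> bool"
  where "seq_complete U \<longleftrightarrow> (\<forall>X. range X \<subseteq> U \<longrightarrow> Cauchy_seq X \<longrightarrow> (\<exists>l\<in>U. seq_lim X l))"

lemma small_minus: "\<lbrakk>0 < t; small t x\<rbrakk> \<Longrightarrow> small t (- x)"
  using small_balanced[of t "-1" x] by simp

lemma small_diff: "0 < t \<Longrightarrow> \<exists>s>0. \<forall>x y. small s x \<longrightarrow> small s y \<longrightarrow> small t (x - y)"
  using small_add[of t] small_minus by (metis diff_conv_add_uminus)

lemma seq_lim_imp_Cauchy_seq:
  assumes "seq_lim X l"
  shows "Cauchy_seq X"
  unfolding Cauchy_seq_def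
proof (intro allI impI)
  fix t :: real
  assume "0 < t"
  then obtain s where s: "0 < s" "\<And>x y. small s x \<Longrightarrow> small s y \<Longrightarrow> small t (x - y)"
    using small_diff by blast
  then obtain n0 where "\<And>n. n \<ge> n0 \<Longrightarrow> small s (X n - l)"
    using assms unfolding seq_lim_def eventually_sequentially by blast
  then have "small t (X n - X m)" if "n \<ge> n0" "m \<ge> n0" for n m
    using s(2)[of "X n - l" "X m - l"] that by simp
  then show "\<exists>n0. \<forall>n\<ge>n0. \<forall>m\<ge>n0. small t (X n - X m)"
    by blast
qed

lemma seq_lim_unique:
  assumes "seq_lim X l" "seq_lim X l'"
  shows "l = l'"
proof -
  have "small t (l' - l)" if t: "0 < t" for t
  proof -
    obtain s where s: "0 < s" "\<And>x y. small s x \<Longrightarrow> small s y \<Longrightarrow> small t (x - y)"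
      using small_diff t by blast
    then have "\<forall>\<^sub>F n in sequentially. small s (X n - l) \<and> small s (X n - l')"
      using assms unfolding seq_lim_def by (auto intro: eventually_conj)
    then obtain n where "small s (X n - l)" "small s (X n - l')"
      using eventually_happens' sequentially_bot by blast
    then show ?thesis
      using s(2) by fastforce
  qed
  then show ?thesis
    using small_Hausdorff[of "l' - l"] by simp
qed

section \<open>Completeness of finitely generated subspaces\<close>

text \<open>Otherwise points of \<open>U\<close> taken in the neighbourhoods of \<open>b\<close>
  with indices 1/(n+1) converge to \<open>b\<close>. Such a sequence is Cauchy, so it also has a
  limit in \<open>U\<close>, and uniqueness of limits puts \<open>b\<close> in
  \<open>U\<close>.\<close>

lemma seq_complete_imp_closed:
  assumes "seq_complete U" "b \<notin> U"
  shows "\<exists>d>0. \<forall>y\<in>U. \<not> small d (y - b)"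
proof (rule ccontr)
  assume "\<not> ?thesis"
  then have "\<forall>n. \<exists>y\<in>U. small (inverse (real (Suc n))) (y - b)"
    by (metis inverse_positive_iff_positive of_nat_0_less_iff zero_less_Suc)
  then obtain Y where Y: "\<And>n. Y n \<in> U" "\<And>n. small (inverse (real (Suc n))) (Y n - b)"
    by metis
  have lim: "seq_lim Y b"
    unfolding seq_lim_def
  proof (intro allI impI)
    fix t :: real
    assume "0 < t"
    then have "\<forall>\<^sub>F n in sequentially. inverse (real (Suc n)) < t"
      by (rule order_tendstoD(2)[OF LIMSEQ_inverse_real_of_nat])
    then show "\<forall>\<^sub>F n in sequentially. small t (Y n - b)"
      by eventually_elim (metis Y(2) inverse_positive_iff_positive less_imp_le of_nat_0_less_iff
          small_mono zero_less_Suc)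
  qed
  then obtain l where "l \<in> U" "seq_lim Y l"
    using assms(1) Y(1) seq_lim_imp_Cauchy_seq unfolding seq_complete_def by blast
  then show False
    using lim seq_lim_unique assms(2) by blast
qed

text \<open>Dividing the difference of two terms by minus its \<open>b\<close>-coordinate gives a
  point of \<open>U\<close> minus \<open>b\<close>. If the difference is small while the coordinate
  is not, that point of \<open>U\<close> comes closer to \<open>b\<close> than
  \<open>seq_complete_imp_closed\<close> allows.\<close>

lemma Cauchy_coordinate:
  fixes c :: "nat \<Rightarrow> real"
  assumes "subspace U" "seq_complete U" "b \<notin> U"
    and Y: "\<And>n. Y n \<in> U"
    and X: "Cauchy_seq (\<lambda>n. c n *\<^sub>R b + Y n)"
  shows "Cauchy c"
proof (rule metric_CauchyI)
  fix \<epsilon> :: real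
  assume \<epsilon>: "0 < \<epsilon>"
  obtain d where d: "0 < d" "\<And>y. y \<in> U \<Longrightarrow> \<not> small d (y - b)"
    using seq_complete_imp_closed assms(2,3) by blast
  \<comment> \<open>The factor is fixed in advance, so one \<open>s\<close> serves all coordinate
    differences of modulus at least \<open>\<epsilon>\<close>.\<close>
  obtain s where s: "0 < s" "\<And>x. small s x \<Longrightarrow> small d ((1 / \<epsilon>) *\<^sub>R x)"
    using small_scaleR[of d "1 / \<epsilon>"] d(1) \<epsilon> by auto
  obtain n0 where n0: "\<And>n m. n \<ge> n0 \<Longrightarrow> m \<ge> n0 \<Longrightarrow>
      small s ((c n *\<^sub>R b + Y n) - (c m *\<^sub>R b + Y m))"
    using X s(1) unfolding Cauchy_seq_def by blast
  have "\<bar>c n - c m\<bar> < \<epsilon>" if nm: "n \<ge> n0" "m \<ge> n0" for n m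
  proof (rule ccontr)
    define k where "k = c n - c m"
    assume "\<not> \<bar>c n - c m\<bar> < \<epsilon>"
    then have k: "\<bar>k\<bar> \<ge> \<epsilon>" "k \<noteq> 0"
      using \<epsilon> by (auto simp: k_def)
    define z where "z = (c n *\<^sub>R b + Y n) - (c m *\<^sub>R b + Y m)"
    have z: "z = k *\<^sub>R b + (Y n - Y m)"
      by (simp add: z_def k_def algebra_simps)
    \<comment> \<open>The scalar -1/k is split so that 1/\<epsilon> is covered by the choice of
      \<open>s\<close> and -\<epsilon>/k, of modulus at most 1, by balancedness.\<close>
    have "small d ((- \<epsilon> / k) *\<^sub>R ((1 / \<epsilon>) *\<^sub>R z))"
      using k \<epsilon> by (intro small_balanced d(1) s(2)) (auto simp: z_def n0 nm divide_simps)
    moreover have "(- \<epsilon> / k) *\<^sub>R ((1 / \<epsilon>) *\<^sub>R z) = (- 1 / k) *\<^sub>R (Y n - Y m) - b"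
      using k(2) \<epsilon> by (simp add: z scaleR_add_right)
    moreover have "(- 1 / k) *\<^sub>R (Y n - Y m) \<in> U"
      using assms(1) Y by (intro subspace_scale subspace_diff)
    ultimately show False
      using d(2) by metis
  qed
  then show "\<exists>M. \<forall>m\<ge>M. \<forall>n\<ge>M. dist (c m) (c n) < \<epsilon>"
    by (auto simp: dist_real_def)
qed

text \<open>If \<open>b\<close> is new, the \<open>b\<close>-coordinates converge by completeness of
  the reals. As short multiples of \<open>b\<close> are small by absorption, subtracting the
  \<open>b\<close>-components leaves a Cauchy sequence in \<open>span B\<close>, and the two limits
  add up.\<close>

lemma seq_complete_span_insert:
  assumes U: "seq_complete (span B)"
  shows "seq_complete (span (insert b B))"
proof (cases "b \<in> span B")
  case True
  then show ?thesis
    using U by (simp add: span_redundant)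
next
  case False
  show ?thesis
    unfolding seq_complete_def
  proof (intro allI impI)
    fix X
    assume "range X \<subseteq> span (insert b B)" and X: "Cauchy_seq X"
    then have "\<exists>k. X n - k *\<^sub>R b \<in> span B" for n
      using span_breakdown_eq[of "X n" b B] by blast
    then obtain c where c: "\<And>n. X n - c n *\<^sub>R b \<in> span B"
      by metis
    define Y where "Y n = X n - c n *\<^sub>R b" for n
    have "Cauchy c"
      using Cauchy_coordinate[OF subspace_span U False, of Y c] c X by (simp add: Y_def)
    then obtain k where k: "c \<longlonglongrightarrow> k"
      using Cauchy_convergent convergent_def by blast
    have "Cauchy_seq Y"
      unfolding Cauchy_seq_def
    proof (intro allI impI)
      fix t :: real
      assume "0 < t"
      then obtain s where s: "0 < s" "\<And>x y. small s x \<Longrightarrow> small s y \<Longrightarrow> small t (x - y)"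
        using small_diff by blast
      obtain \<delta> where \<delta>: "0 < \<delta>" "\<And>a. \<bar>a\<bar> < \<delta> \<Longrightarrow> small s (a *\<^sub>R b)"
        using small_absorbing s(1) by blast
      obtain n1 where n1: "\<And>n m. n \<ge> n1 \<Longrightarrow> m \<ge> n1 \<Longrightarrow> \<bar>c n - c m\<bar> < \<delta>"
        using \<open>Cauchy c\<close> \<delta>(1) unfolding Cauchy_def dist_real_def by blast
      obtain n2 where n2: "\<And>n m. n \<ge> n2 \<Longrightarrow> m \<ge> n2 \<Longrightarrow> small s (X n - X m)"
        using X s(1) unfolding Cauchy_seq_def by blast
      have "small t (Y n - Y m)" if "n \<ge> max n1 n2" "m \<ge> max n1 n2" for n m
      proof -
        have "Y n - Y m = (X n - X m) - (c n - c m) *\<^sub>R b"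
          by (simp add: Y_def algebra_simps)
        then show ?thesis
          using s(2) \<delta>(2) n1 n2 that by simp
      qed
      then show "\<exists>n0. \<forall>n\<ge>n0. \<forall>m\<ge>n0. small t (Y n - Y m)"
        by blast
    qed
    moreover have "range Y \<subseteq> span B"
      using c by (auto simp: Y_def)
    ultimately obtain y where y: "y \<in> span B" "seq_lim Y y"
      using U unfolding seq_complete_def by blast
    have "seq_lim X (k *\<^sub>R b + y)"
      unfolding seq_lim_def
    proof (intro allI impI)
      fix t :: real
      assume "0 < t"
      then obtain s where s: "0 < s" "\<And>x y. small s x \<Longrightarrow> small s y \<Longrightarrow> small t (x + y)"
        using small_add by blast
      obtain \<delta> where \<delta>: "0 < \<delta>" "\<And>a. \<bar>a\<bar> < \<delta> \<Longrightarrow> small s (a *\<^sub>R b)"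
        using small_absorbing s(1) by blast
      have "\<forall>\<^sub>F n in sequentially. \<bar>c n - k\<bar> < \<delta>"
        using tendstoD[OF k \<delta>(1)] by (simp add: dist_real_def)
      moreover have "\<forall>\<^sub>F n in sequentially. small s (Y n - y)"
        using y(2) s(1) unfolding seq_lim_def by blast
      ultimately show "\<forall>\<^sub>F n in sequentially. small t (X n - (k *\<^sub>R b + y))"
      proof eventually_elim
        case (elim n)
        then have "small t ((c n - k) *\<^sub>R b + (Y n - y))"
          using s(2) \<delta>(2) by blast
        moreover have "(c n - k) *\<^sub>R b + (Y n - y) = X n - (k *\<^sub>R b + y)"
          by (simp add: Y_def algebra_simps)
        ultimately show ?case
          by simp
      qed
    qed
    moreover have "k *\<^sub>R b + y \<in> span (insert b B)"
      using y(1) by (simp add: span_breakdown_eq) (metis add_diff_cancel_left')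
    ultimately show "\<exists>l\<in>span (insert b B). seq_lim X l"
      by blast
  qed
qed

lemma seq_complete_span:
  assumes "finite B"
  shows "seq_complete (span B)"
  using assms
proof (induction B)
  case empty
  have "seq_lim X 0" if "range X \<subseteq> {0}" for X
  proof -
    \<comment> \<open>The scalar 0 is within every absorption bound.\<close>
    have "small t 0" if "0 < t" for t
      using small_absorbing[of t 0] that by (metis abs_zero scaleR_zero_left)
    moreover have "X n = 0" for n
      using that by blast
    ultimately show ?thesis
      by (simp add: seq_lim_def)
  qed
  then show ?case
    by (simp add: seq_complete_def)
next
  case (insert b B)
  then show ?case
    by (simp add: seq_complete_span_insert)
qed

end

section \<open>The topology of an intuitionistic fuzzy normed space\<close>

context intuitionistic_fuzzy_normed_space
begin

text \<open>Split \<open>x\<close> as x + 0 and \<open>t\<close> as s + (t - s): the second factor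
  is then 1, the unit of \<open>T\<close>. The split needs s < t, hence the separate case of
  equality.\<close>

lemma mu_mono:
  assumes "0 < s" "s \<le> t"
  shows "\<mu> x s \<le> \<mu> x t"
proof (cases "s = t")
  case False
  then have "T (\<mu> x s) (\<mu> 0 (t - s)) \<le> \<mu> x t"
    using mu_add[of s "t - s" x 0] assms by simp
  moreover have "\<mu> 0 (t - s) = 1"
    using mu_eq_1_iff[of "t - s" 0] False assms by simp
  ultimately show ?thesis
    using norm_op.unit mu_range[OF assms(1)] by simp
qed simp

text \<open>Dual to \<open>mu_mono\<close>: the zero vector contributes 0, the unit of
  \<open>S\<close>.\<close>

lemma nu_antimono:
  assumes "0 < s" "s \<le> t"
  shows "\<nu> x t \<le> \<nu> x s"
proof (cases "s = t")
  case False
  then have "\<nu> x t \<le> S (\<nu> x s) (\<nu> 0 (t - s))"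
    using nu_add[of s "t - s" x 0] assms by simp
  moreover have "\<nu> 0 (t - s) = 0"
    using nu_eq_0_iff[of "t - s" 0] False assms by simp
  ultimately show ?thesis
    using conorm_op.unit nu_range[OF assms(1)] by simp
qed simp

text \<open>A single parameter serves both as the argument of \<open>\<mu>\<close> and
  \<open>\<nu>\<close> and as the tolerance, much as in the Ky Fan metric. This gives a base indexed
  by one positive real.\<close>

definition small :: "real \<Rightarrow> 'v \<Rightarrow> bool"
  where "small t x \<longleftrightarrow> \<mu> x t > 1 - t \<and> \<nu> x t < t"

text \<open>Separates the two roles of the parameter: by monotonicity the argument may grow to
  \<open>t\<close> while the tolerance stays \<open>s\<close>.\<close>

lemma smallD:
  assumes "small s x" "0 < s" "s \<le> t"
  shows "\<mu> x t > 1 - s" "\<nu> x t < s"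
  using assms mu_mono[of s t x] nu_antimono[of s t x] by (auto simp: small_def)

text \<open>This is continuity of \<open>T\<close> at (1, 1), where its value is 1.\<close>

lemma t_norm_near_1:
  assumes "0 < t"
  shows "\<exists>\<delta>>0. \<forall>a\<in>{0..1}. \<forall>b\<in>{0..1}. a > 1 - \<delta> \<longrightarrow> b > 1 - \<delta> \<longrightarrow> T a b > 1 - t"
proof -
  obtain d where d: "0 < d" "\<And>p. p \<in> {0..1} \<times> {0..1} \<Longrightarrow> dist p (1, 1) < d \<Longrightarrow>
      dist (case p of (a, b) \<Rightarrow> T a b) (T 1 1) < t"
    using norm_op.continuous assms unfolding continuous_on_iff by fastforce
  have "T a b > 1 - t"
    if "a \<in> {0..1}" "b \<in> {0..1}" "a > 1 - d / 2" "b > 1 - d / 2" for a b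
  proof -
    \<comment> \<open>The distance of pairs is at most the sum of the coordinate distances, so d/2
      in each coordinate suffices.\<close>
    have "dist (a, b) (1, 1) \<le> \<bar>a - 1\<bar> + \<bar>b - 1\<bar>"
      by (simp add: dist_Pair_Pair dist_real_def sqrt_sum_squares_le_sum_abs)
    then have "dist (a, b) (1, 1) < d"
      using that by auto
    then show ?thesis
      using d(2)[of "(a, b)"] that norm_op.unit[of 1] by (auto simp: dist_real_def)
  qed
  then show ?thesis
    using d(1) by (intro exI[of _ "d / 2"]) auto
qed

text \<open>This is continuity of \<open>S\<close> at (0, 0), where its value is 0.\<close>

lemma t_conorm_near_0:
  assumes "0 < t"
  shows "\<exists>\<delta>>0. \<forall>a\<in>{0..1}. \<forall>b\<in>{0..1}. a < \<delta> \<longrightarrow> b < \<delta> \<longrightarrow> S a b < t"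
proof -
  obtain d where d: "0 < d" "\<And>p. p \<in> {0..1} \<times> {0..1} \<Longrightarrow> dist p (0, 0) < d \<Longrightarrow>
      dist (case p of (a, b) \<Rightarrow> S a b) (S 0 0) < t"
    using conorm_op.continuous assms unfolding continuous_on_iff by fastforce
  have "S a b < t" if "a \<in> {0..1}" "b \<in> {0..1}" "a < d / 2" "b < d / 2" for a b
  proof -
    have "dist (a, b) (0, 0) \<le> \<bar>a\<bar> + \<bar>b\<bar>"
      using sqrt_sum_squares_le_sum_abs[of a b] by (simp add: dist_Pair_Pair dist_real_def)
    then have "dist (a, b) (0, 0) < d"
      using that by auto
    then show ?thesis
      using d(2)[of "(a, b)"] that conorm_op.unit[of 0] by (auto simp: dist_real_def)
  qed
  then show ?thesis
    using d(1) by (intro exI[of _ "d / 2"]) auto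
qed

text \<open>Addition rests on the triangle inequalities and continuity of \<open>T\<close> and
  \<open>S\<close> at the unit corners, scaling on homogeneity and monotonicity, absorption on the
  limits at infinity, and separation on \<open>nu_eq_0_iff\<close>.\<close>

sublocale zero_neighbourhoods small
proof
  show "small t x" if "0 < s" "s \<le> t" "small s x" for s t x
    using smallD[OF that(3,1,2)] that by (simp add: small_def)
next
  fix t :: real
  assume t: "0 < t"
  obtain d where d: "0 < d" "\<And>a b. a \<in> {0..1} \<Longrightarrow> b \<in> {0..1} \<Longrightarrow> a > 1 - d \<Longrightarrow> b > 1 - d \<Longrightarrow>
      T a b > 1 - t"
    using t_norm_near_1[OF t] by blast
  obtain e where e: "0 < e" "\<And>a b. a \<in> {0..1} \<Longrightarrow> b \<in> {0..1} \<Longrightarrow> a < e \<Longrightarrow> b < e \<Longrightarrow> S a b < t"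
    using t_conorm_near_0[OF t] by blast
  \<comment> \<open>The triangle inequalities divide the argument \<open>t\<close> into two halves;
    \<open>d\<close> and \<open>e\<close> bound the tolerances.\<close>
  define s where "s = min (t / 2) (min d e)"
  have s: "0 < s" "s \<le> t / 2" "s \<le> d" "s \<le> e"
    using t d(1) e(1) by (auto simp: s_def)
  have "small t (x + y)" if "small s x" "small s y" for x y
  proof -
    note x = smallD[OF that(1) s(1,2)] and y = smallD[OF that(2) s(1,2)]
    have "T (\<mu> x (t / 2)) (\<mu> y (t / 2)) > 1 - t"
      using x y s t by (intro d(2) mu_range) auto
    moreover have "S (\<nu> x (t / 2)) (\<nu> y (t / 2)) < t"
      using x y s t by (intro e(2) nu_range) auto
    ultimately show ?thesis
      using mu_add[of "t / 2" "t / 2" x y] nu_add[of "t / 2" "t / 2" x y] t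
      by (simp add: small_def)
  qed
  then show "\<exists>s>0. \<forall>x y. small s x \<longrightarrow> small s y \<longrightarrow> small t (x + y)"
    using s(1) by blast
next
  fix t a :: real and x
  assume t: "0 < t" and a: "\<bar>a\<bar> \<le> 1" and x: "small t x"
  show "small t (a *\<^sub>R x)"
  proof (cases "a = 0")
    case True
    then show ?thesis
      using t mu_eq_1_iff[OF t, of 0] nu_eq_0_iff[OF t, of 0] by (simp add: small_def)
  next
    case False
    then have "t \<le> t / \<bar>a\<bar>"
      using a t by (simp add: divide_simps)
    then show ?thesis
      using smallD[OF x t] False t by (simp add: small_def mu_scaleR nu_scaleR)
  qed
next
  fix t a :: real
  assume t: "0 < t" and a: "a \<noteq> 0"
  \<comment> \<open>Homogeneity moves the argument to t/|a|, which \<open>s\<close> must not exceed;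
    the bound by \<open>t\<close> controls the tolerance.\<close>
  define s where "s = min t (t / \<bar>a\<bar>)"
  have s: "0 < s" "s \<le> t" "s \<le> t / \<bar>a\<bar>"
    using t a by (auto simp: s_def)
  have "small t (a *\<^sub>R x)" if "small s x" for x
    using smallD[OF that s(1,3)] s(2) t a by (simp add: small_def mu_scaleR nu_scaleR)
  then show "\<exists>s>0. \<forall>x. small s x \<longrightarrow> small t (a *\<^sub>R x)"
    using s(1) by blast
next
  fix t :: real and x
  assume t: "0 < t"
  have "\<forall>\<^sub>F r in at_top. \<mu> x r > 1 - t \<and> \<nu> x r < t"
    using order_tendstoD(1)[OF mu_at_top, of "1 - t" x] order_tendstoD(2)[OF nu_at_top, of t x] t
    by (auto intro: eventually_conj)
  then obtain M where M: "\<And>r. r \<ge> M \<Longrightarrow> \<mu> x r > 1 - t \<and> \<nu> x r < t"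
    unfolding eventually_at_top_linorder by blast
  \<comment> \<open>For nonzero \<open>a\<close> below this bound, t/|a| is at least
    \<open>M\<close>. The maximum with 1 keeps the divisor positive.\<close>
  define \<delta> where "\<delta> = t / max M 1"
  have "small t (a *\<^sub>R x)" if "\<bar>a\<bar> < \<delta>" for a
  proof (cases "a = 0")
    case True
    then show ?thesis
      using t mu_eq_1_iff[OF t, of 0] nu_eq_0_iff[OF t, of 0] by (simp add: small_def)
  next
    case False
    have "max M 1 * \<bar>a\<bar> < t"
      using that by (simp add: \<delta>_def less_divide_eq mult.commute)
    then have "max M 1 \<le> t / \<bar>a\<bar>"
      using False by (simp add: le_divide_eq)
    then show ?thesis
      using M[of "t / \<bar>a\<bar>"] False t by (simp add: small_def mu_scaleR nu_scaleR)
  qed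
  then show "\<exists>\<delta>>0. \<forall>a. \<bar>a\<bar> < \<delta> \<longrightarrow> small t (a *\<^sub>R x)"
    using t by (intro exI[of _ \<delta>]) (auto simp: \<delta>_def)
next
  fix x
  assume small: "\<And>t. 0 < t \<Longrightarrow> small t x"
  \<comment> \<open>Capping the parameter at 1 keeps it below the fixed argument 1, while its
    tolerance can be made arbitrarily small.\<close>
  have "\<nu> x 1 \<le> 0"
  proof (rule field_le_epsilon)
    fix e :: real
    assume "0 < e"
    then show "\<nu> x 1 \<le> 0 + e"
      using smallD(2)[OF small, of "min e 1" 1] by auto
  qed
  then show "x = 0"
    using nu_range[of 1 x] nu_eq_0_iff[of 1 x] by simp
qed

section \<open>Transfer to fuzzy Cauchy and convergent sequences\<close>

lemma ifn_Cauchy_imp_Cauchy_seq: "ifn_Cauchy \<mu> \<nu> X \<Longrightarrow> Cauchy_seq X"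
  by (simp add: ifn_Cauchy_def Cauchy_seq_def small_def)

lemma seq_lim_imp_ifn_converges:
  assumes "seq_lim X l"
  shows "ifn_converges \<mu> \<nu> X l"
  unfolding ifn_converges_def
proof (intro allI impI)
  fix t :: real
  assume t: "0 < t"
  have close: "\<forall>\<^sub>F n in sequentially. \<mu> (X n - l) t > 1 - e \<and> \<nu> (X n - l) t < e" if "0 < e" for e
  proof -
    \<comment> \<open>The minimum gives tolerance at most \<open>e\<close> and leaves room to raise
      the argument to \<open>t\<close>.\<close>
    have "\<forall>\<^sub>F n in sequentially. small (min e t) (X n - l)"
      using assms t that unfolding seq_lim_def by simp
    then show ?thesis
    proof eventually_elim
      case (elim n)
      then show ?case
        using smallD[OF elim, of t] t that by simp
    qed
  qed
  have "\<forall>\<^sub>F n in sequentially. dist (\<mu> (X n - l) t) 1 < e" if "0 < e" for e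
    using close[OF that]
  proof eventually_elim
    case (elim n)
    then show ?case
      using mu_range[OF t, of "X n - l"] that by (simp add: dist_real_def abs_less_iff)
  qed
  moreover have "\<forall>\<^sub>F n in sequentially. dist (\<nu> (X n - l) t) 0 < e" if "0 < e" for e
    using close[OF that]
  proof eventually_elim
    case (elim n)
    then show ?case
      using nu_range[OF t, of "X n - l"] by simp
  qed
  ultimately show "(\<lambda>n. \<mu> (X n - l) t) \<longlonglongrightarrow> 1 \<and> (\<lambda>n. \<nu> (X n - l) t) \<longlonglongrightarrow> 0"
    by (simp add: tendsto_iff)
qed

lemma ifn_complete_if_finite_span:
  assumes "finite B" "span B = (UNIV :: 'v set)"
  shows "ifn_complete \<mu> \<nu>"
  using seq_complete_span[OF assms(1)] assms(2) ifn_Cauchy_imp_Cauchy_seq seq_lim_imp_ifn_converges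
  unfolding ifn_complete_def seq_complete_def by blast

end

theorem corollary6p8:
  fixes T S :: "real \<Rightarrow> real \<Rightarrow> real"
    and \<mu> \<nu> :: "'v::real_vector \<Rightarrow> real \<Rightarrow> real"
  assumes "intuitionistic_fuzzy_normed_space T S \<mu> \<nu>"
    and "\<exists>B. finite_dimensional_vector_space ((*\<^sub>R) :: real \<Rightarrow> 'v \<Rightarrow> 'v) B"
    and "\<And>a b. \<lbrakk>a \<in> {0..1}; b \<in> {0..1}\<rbrakk> \<Longrightarrow> S a b = max a b"
  shows "ifn_complete \<mu> \<nu>"
proof -
  obtain B where "finite_dimensional_vector_space ((*\<^sub>R) :: real \<Rightarrow> 'v \<Rightarrow> 'v) B"
    using assms(2) by blast
  note B = finite_dimensional_vector_space.finite_Basis[OF this]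
    finite_dimensional_vector_space.span_Basis[OF this]
  \<comment> \<open>\<open>span_raw_def\<close> links the span of the generic vector space locale at
    \<open>scaleR\<close> with \<open>span\<close> on real vector spaces.\<close>
  have "span B = UNIV"
    using B(2) by (simp add: span_raw_def)
  then show ?thesis
    using intuitionistic_fuzzy_normed_space.ifn_complete_if_finite_span assms(1) B(1) by blast
qed

end
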